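(* Let $(L,[-,-,-])$ be a ternary Leibniz algebra over a field $\mathbb{K}$ and let $\beta:L\to L$ be an injective averaging operator on it. Then $L$ endowed with the new multiplication $[-,-,-]_\beta:L\times L\times L\to L$ defined by $$[x,y,z]_\beta:=[\beta(x),\beta(y),z]$$ for all $x,y,z\in L$ is a ternary Leibniz algebra.
   Context: A ternary Leibniz algebra is a vector space $L$ with a trilinear bracket satisfying $[[x,y,z],t,u]=[x,y,[z,t,u]]+[x,[y,t,u],z]+[[x,t,u],y,z]$ for all $x,y,z,t,u\in L$. An averaging operator on it is a linear map $\beta:L\to L$ with $\beta([\beta(x),\beta(y),z])=\beta([\beta(x),y,\beta(z)])=\beta([x,\beta(y),\beta(z)])=[\beta(x),\beta(y),\beta(z)]$ for all $x,y,z\in L$. *)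

theory Defs
  imports Complex_Main
begin

locale ternary_leibniz_algebra = vector_space scale
  for scale :: "'k::field \<Rightarrow> 'a::ab_group_add \<Rightarrow> 'a" +
  fixes bracket :: "'a \<Rightarrow> 'a \<Rightarrow> 'a \<Rightarrow> 'a"
  assumes linear_bracket_1: "Vector_Spaces.linear scale scale (\<lambda>x. bracket x y z)"
    and linear_bracket_2: "Vector_Spaces.linear scale scale (\<lambda>y. bracket x y z)"
    and linear_bracket_3: "Vector_Spaces.linear scale scale (\<lambda>z. bracket x y z)"
    and ternary_leibniz_identity:
      "bracket (bracket x y z) t u =
         bracket x y (bracket z t u) + bracket x (bracket y t u) z + bracket (bracket x t u) y z"

locale averaging_operator = ternary_leibniz_algebra scale bracket
  for scale :: "'k::field \<Rightarrow> 'a::ab_group_add \<Rightarrow> 'a"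
    and bracket :: "'a \<Rightarrow> 'a \<Rightarrow> 'a \<Rightarrow> 'a" +
  fixes \<beta> :: "'a \<Rightarrow> 'a"
  assumes linear_averaging: "Vector_Spaces.linear scale scale \<beta>"
    and averaging_12: "\<beta> (bracket (\<beta> x) (\<beta> y) z) = bracket (\<beta> x) (\<beta> y) (\<beta> z)"
    and averaging_13: "\<beta> (bracket (\<beta> x) y (\<beta> z)) = bracket (\<beta> x) (\<beta> y) (\<beta> z)"
    and averaging_23: "\<beta> (bracket x (\<beta> y) (\<beta> z)) = bracket (\<beta> x) (\<beta> y) (\<beta> z)"

end

theory Submission
  imports Defs
begin

text \<open>
  Put \<open>w = [\<beta> y, \<beta> t, u]\<close>. Expanding \<open>[[x, y, z]\<^sub>\<beta>, t, u]\<^sub>\<beta> = [[\<beta> x, \<beta> y, \<beta> z], \<beta> t, u]\<close> by the Leibniz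
  identity of the original bracket gives a summand \<open>[\<beta> x, w, \<beta> z]\<close>, whereas the Leibniz identity for
  the new bracket asks for \<open>[\<beta> x, \<beta> w, z]\<close> in its place; the summand with the inner bracket in first
  position has the same defect. The averaging identities say that the two candidates have the same
  image under \<open>\<beta>\<close>, so injectivity makes them equal: \<open>\<beta>\<close> may be moved from one slot of the bracket to
  another as long as two slots carry it.
\<close>

lemma (in averaging_operator) injective_slot_shift_23:
  assumes "inj \<beta>"
  shows "bracket (\<beta> x) w (\<beta> z) = bracket (\<beta> x) (\<beta> w) z"
  using assms by (rule injD) (simp add: averaging_12 averaging_13)

lemma (in averaging_operator) injective_slot_shift_13:
  assumes "inj \<beta>"
  shows "bracket w (\<beta> y) (\<beta> z) = bracket (\<beta> w) (\<beta> y) z"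
  using assms by (rule injD) (simp add: averaging_12 averaging_23)

theorem lemma2p4:
  fixes scale :: "'k::field \<Rightarrow> 'a::ab_group_add \<Rightarrow> 'a"
    and bracket :: "'a \<Rightarrow> 'a \<Rightarrow> 'a \<Rightarrow> 'a"
    and \<beta> :: "'a \<Rightarrow> 'a"
  assumes "ternary_leibniz_algebra scale bracket"
    and "averaging_operator scale bracket \<beta>"
    and "inj \<beta>"
  shows "ternary_leibniz_algebra scale (\<lambda>x y z. bracket (\<beta> x) (\<beta> y) z)"
proof -
  interpret averaging_operator scale bracket \<beta> by (fact assms(2))
  note shifts = injective_slot_shift_13[OF assms(3)] injective_slot_shift_23[OF assms(3)]
  show ?thesis
  proof (intro ternary_leibniz_algebra.intro ternary_leibniz_algebra_axioms.intro vector_space_axioms)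
    fix x y z t u :: 'a
    show "Vector_Spaces.linear scale scale (\<lambda>x. bracket (\<beta> x) (\<beta> y) z)"
      using Vector_Spaces.linear_compose[OF linear_averaging linear_bracket_1] by (simp add: o_def)
    show "Vector_Spaces.linear scale scale (\<lambda>y. bracket (\<beta> x) (\<beta> y) z)"
      using Vector_Spaces.linear_compose[OF linear_averaging linear_bracket_2] by (simp add: o_def)
    show "Vector_Spaces.linear scale scale (\<lambda>z. bracket (\<beta> x) (\<beta> y) z)"
      by (rule linear_bracket_3)
    have "bracket (\<beta> (bracket (\<beta> x) (\<beta> y) z)) (\<beta> t) u
        = bracket (bracket (\<beta> x) (\<beta> y) (\<beta> z)) (\<beta> t) u"
      by (simp only: averaging_12)
    also have "\<dots> = bracket (\<beta> x) (\<beta> y) (bracket (\<beta> z) (\<beta> t) u)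
        + bracket (\<beta> x) (bracket (\<beta> y) (\<beta> t) u) (\<beta> z)
        + bracket (bracket (\<beta> x) (\<beta> t) u) (\<beta> y) (\<beta> z)"
      by (rule ternary_leibniz_identity)
    also have "\<dots> = bracket (\<beta> x) (\<beta> y) (bracket (\<beta> z) (\<beta> t) u)
        + bracket (\<beta> x) (\<beta> (bracket (\<beta> y) (\<beta> t) u)) z
        + bracket (\<beta> (bracket (\<beta> x) (\<beta> t) u)) (\<beta> y) z"
      using shifts(1)[of "bracket (\<beta> x) (\<beta> t) u" y z]
        shifts(2)[of x "bracket (\<beta> y) (\<beta> t) u" z] by (simp only:)
    finally show "bracket (\<beta> (bracket (\<beta> x) (\<beta> y) z)) (\<beta> t) u
        = bracket (\<beta> x) (\<beta> y) (bracket (\<beta> z) (\<beta> t) u)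
        + bracket (\<beta> x) (\<beta> (bracket (\<beta> y) (\<beta> t) u)) z
        + bracket (\<beta> (bracket (\<beta> x) (\<beta> t) u)) (\<beta> y) z" .
  qed
qed

end
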